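(* The Nash bargaining problem (NBP) defined in the context is not guaranteed to be a concave (convex) optimization problem in the variables $\{\alpha_i\},\{\beta_i\},\{\gamma_i\},\{P_i^{s0}\},\{P_i^{s1}\}$ and $P^r$; that is, there exist parameter values for which (NBP) is not the maximization of a concave function over a convex feasible set.
   Context: Parameters: an integer $N\ge 1$ (number of source-destination pairs $(s_i,d_i)$, served by one relay $r$), real constants $T>0$, $P_0^s>0$, $P_0^r>0$, $\sigma^2>0$, $\eta\in(0,1)$, $E_0\ge 0$, $\theta_0>0$, and channel gains $h_i,g_i\in\mathbb{C}$ for $1\le i\le N$. Variables: reals $P_i^{s0},P_i^{s1},\alpha_i,\beta_i,\gamma_i$ ($1\le i\le N$) and $P^r$, with $\alpha_i,\beta_i,\gamma_i\ge 0$. Define $$C_i=\min\Big\{\beta_i\log\big(1+\tfrac{P_i^{s0}|h_i|^2}{\sigma^2}\big),\ \gamma_i\log\big(1+\tfrac{P^r|g_i|^2}{\sigma^2}\big)\Big\},\qquad U_i^S=\frac{C_i}{P_i^{s1}\alpha_i+P_i^{s0}\beta_i},$$ $$U^R=\eta\sum_{i=1}^N\alpha_iT P_i^{s1}|h_i|^2-\Big(\sum_{i=1}^N\gamma_iTP^r+E_0\Big).$$ (NBP): maximize $\Phi=\big(\prod_{i=1}^N U_i^S\big)U^R$ over all variables subject to $U_i^S>0$ for all $i$; $U^R>0$; $\max_i(\alpha_iT)+\sum_{i=1}^N(\beta_i+\gamma_i)T=T$; $(\beta_i+\gamma_i)T\ge\theta_0T$ for all $i$; $0\le P_i^{s1}\le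 P_0^s$ and $0\le P_i^{s0}\le P_0^s$ for all $i$; $0\le P^r\le P_0^r$. *)

theory Defs
  imports "HOL-Analysis.Analysis" "HOL-Analysis.Finite_Function_Topology"
begin

record nbp_params =
  num_pairs :: nat                   (* N *)
  duration :: real                   (* T *)
  source_power_max :: real           (* P_0^s *)
  relay_power_max :: real            (* P_0^r *)
  noise_var :: real                  (* sigma^2, the variance itself *)
  efficiency :: real                 (* eta *)
  relay_energy :: real               (* E_0 *)
  min_fraction :: real               (* theta_0 *)
  source_gain :: "nat \<Rightarrow> complex"    (* h *)
  relay_gain :: "nat \<Rightarrow> complex"     (* g *)

definition nbp_params_valid :: "nbp_params \<Rightarrow> bool" where
  "nbp_params_valid p \<longleftrightarrow>
     num_pairs p \<ge> 1 \<and> duration p > 0 \<and> source_power_max p > 0 \<and> relay_power_max p > 0 \<and>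
     noise_var p > 0 \<and> 0 < efficiency p \<and> efficiency p < 1 \<and> relay_energy p \<ge> 0 \<and>
     min_fraction p > 0"

(* A point is (P^{s0}, P^{s1}, alpha, beta, gamma, P^r). Since N is a term, a vector of R^N is
   represented by a finitely supported function whose support lies in {1..N}; the operations of
   the ambient real vector space are then exactly those of R^N. *)
type_synonym nbp_vars =
  "(nat \<Rightarrow>\<^sub>0 real) \<times> (nat \<Rightarrow>\<^sub>0 real) \<times> (nat \<Rightarrow>\<^sub>0 real) \<times> (nat \<Rightarrow>\<^sub>0 real) \<times> (nat \<Rightarrow>\<^sub>0 real) \<times> real"

abbreviation nbp_component :: "(nat \<Rightarrow>\<^sub>0 real) \<Rightarrow> nat \<Rightarrow> real"  (infixl "$." 95) where
  "x $. i \<equiv> Poly_Mapping.lookup x i"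

(* The base of the logarithm is taken to be e; another base b > 1 multiplies every C_i by the
   same positive constant. *)
fun nbp_C :: "nbp_params \<Rightarrow> nbp_vars \<Rightarrow> nat \<Rightarrow> real" where
  "nbp_C p (Ps0, Ps1, \<alpha>, \<beta>, \<gamma>, Pr) i =
     min (\<beta> $. i * ln (1 + Ps0 $. i * (cmod (source_gain p i))\<^sup>2 / noise_var p))
         (\<gamma> $. i * ln (1 + Pr * (cmod (relay_gain p i))\<^sup>2 / noise_var p))"

fun nbp_US :: "nbp_params \<Rightarrow> nbp_vars \<Rightarrow> nat \<Rightarrow> real" where
  "nbp_US p (Ps0, Ps1, \<alpha>, \<beta>, \<gamma>, Pr) i =
     nbp_C p (Ps0, Ps1, \<alpha>, \<beta>, \<gamma>, Pr) i / (Ps1 $. i * \<alpha> $. i + Ps0 $. i * \<beta> $. i)"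

fun nbp_UR :: "nbp_params \<Rightarrow> nbp_vars \<Rightarrow> real" where
  "nbp_UR p (Ps0, Ps1, \<alpha>, \<beta>, \<gamma>, Pr) =
     efficiency p *
       (\<Sum>i=1..num_pairs p. \<alpha> $. i * duration p * Ps1 $. i * (cmod (source_gain p i))\<^sup>2)
     - ((\<Sum>i=1..num_pairs p. \<gamma> $. i * duration p * Pr) + relay_energy p)"

definition nbp_objective :: "nbp_params \<Rightarrow> nbp_vars \<Rightarrow> real" where
  "nbp_objective p x = (\<Prod>i=1..num_pairs p. nbp_US p x i) * nbp_UR p x"

(* Where P_i^{s1} alpha_i + P_i^{s0} beta_i = 0, U_i^S is undefined in the mathematics; here it is 0
   (x / 0 = 0), so the constraint U_i^S > 0 excludes such points. *)
definition nbp_feasible :: "nbp_params \<Rightarrow> nbp_vars set" where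
  "nbp_feasible p = {(Ps0, Ps1, \<alpha>, \<beta>, \<gamma>, Pr).
     (\<forall>v\<in>{Ps0, Ps1, \<alpha>, \<beta>, \<gamma>}. Poly_Mapping.keys v \<subseteq> {1..num_pairs p}) \<and>
     (\<forall>i\<in>{1..num_pairs p}. \<alpha> $. i \<ge> 0 \<and> \<beta> $. i \<ge> 0 \<and> \<gamma> $. i \<ge> 0) \<and>
     (\<forall>i\<in>{1..num_pairs p}. nbp_US p (Ps0, Ps1, \<alpha>, \<beta>, \<gamma>, Pr) i > 0) \<and>
     nbp_UR p (Ps0, Ps1, \<alpha>, \<beta>, \<gamma>, Pr) > 0 \<and>
     (MAX i\<in>{1..num_pairs p}. \<alpha> $. i * duration p)
       + (\<Sum>i=1..num_pairs p. (\<beta> $. i + \<gamma> $. i) * duration p) = duration p \<and>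
     (\<forall>i\<in>{1..num_pairs p}. (\<beta> $. i + \<gamma> $. i) * duration p \<ge> min_fraction p * duration p) \<and>
     (\<forall>i\<in>{1..num_pairs p}. 0 \<le> Ps1 $. i \<and> Ps1 $. i \<le> source_power_max p) \<and>
     (\<forall>i\<in>{1..num_pairs p}. 0 \<le> Ps0 $. i \<and> Ps0 $. i \<le> source_power_max p) \<and>
     0 \<le> Pr \<and> Pr \<le> relay_power_max p}"

end

(* The feasible set itself fails to be convex, because -gamma P^r enters U^R bilinearly: take N = 1,
   fix alpha, P^{s0} and P^{s1}, and let beta = 1/2 - gamma absorb the time constraint. Then U^R > 0
   reads gamma P^r < 1/20, which holds for (gamma, P^r) = (1/10, 4/10) and (4/10, 1/10), but not at
   their midpoint, where gamma P^r = 1/16. *)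
theory Submission
  imports Defs
begin

lemma lookup_scaleR:
  fixes x :: "'a \<Rightarrow>\<^sub>0 'b::real_vector"
  shows "Poly_Mapping.lookup (r *\<^sub>R x) k = r *\<^sub>R Poly_Mapping.lookup x k"
proof -
  \<comment> \<open>Scaling is defined through \<open>Abs_poly_mapping\<close>, so reading an entry
    back requires finite support; scaling cannot enlarge the support of \<open>x\<close>.\<close>
  have "finite {k. r *\<^sub>R Poly_Mapping.lookup x k \<noteq> 0}"
    by (rule finite_subset[OF _ finite_keys[of x]]) (auto simp: in_keys_iff)
  then show ?thesis
    by (simp add: scaleR_poly_mapping_def)
qed

text \<open>With \<alpha> = 1/2 and full source power the harvested energy is 1/4. The relay energy
  1/5 leaves the bound 1/20, chosen to lie strictly between the products 1/25 at the endpoints and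
  1/16 at their midpoint.\<close>

definition witness_params :: nbp_params where
  "witness_params = \<lparr>num_pairs = 1, duration = 1, source_power_max = 1, relay_power_max = 1,
     noise_var = 1, efficiency = 1/2, relay_energy = 1/5, min_fraction = 1/10,
     source_gain = (\<lambda>_. 1), relay_gain = (\<lambda>_. 1)\<rparr>"

definition witness_point :: "real \<Rightarrow> real \<Rightarrow> nbp_vars" where
  "witness_point c q =
     (Poly_Mapping.single 1 1, Poly_Mapping.single 1 1, Poly_Mapping.single 1 (1/2),
      Poly_Mapping.single 1 (1/2 - c), Poly_Mapping.single 1 c, q)"

lemma witness_params_valid: "nbp_params_valid witness_params"
  by (simp add: nbp_params_valid_def witness_params_def)

lemma witness_UR: "nbp_UR witness_params (witness_point c q) = 1/20 - c * q"
  by (simp add: witness_params_def witness_point_def)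

text \<open>The bounds on \<open>c\<close> and \<open>q\<close> make both arguments of the minimum
  in \<open>nbp_C\<close> positive, and the denominator of \<open>nbp_US\<close> is 1 -
  \<open>c\<close>.\<close>

lemma witness_feasible:
  assumes "0 < c" "c < 1/2" "0 < q" "q \<le> 1" "c * q < 1/20"
  shows "witness_point c q \<in> nbp_feasible witness_params"
  using assms
  by (auto simp: nbp_feasible_def witness_params_def witness_point_def intro!: divide_pos_pos mult_pos_pos)

lemma feasible_UR_pos: "x \<in> nbp_feasible p \<Longrightarrow> nbp_UR p x > 0"
  by (auto simp: nbp_feasible_def)

lemma single_midpoint:
  fixes a b :: real
  shows "(1/2) *\<^sub>R Poly_Mapping.single k a + (1/2) *\<^sub>R Poly_Mapping.single k b
           = Poly_Mapping.single k ((a + b) / 2)"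
  by (rule poly_mapping_eqI) (simp add: lookup_add lookup_single lookup_scaleR when_def add_divide_distrib)

text \<open>Every component is affine in (\<open>c\<close>, \<open>q\<close>), so the family is
  closed under midpoints and \<open>witness_UR\<close> applies there again.\<close>

lemma witness_midpoint:
  "(1/2) *\<^sub>R witness_point c q + (1/2) *\<^sub>R witness_point c' q'
     = witness_point ((c + c') / 2) ((q + q') / 2)"
proof -
  have "((1/2 - c) + (1/2 - c')) / 2 = 1/2 - (c + c') / 2"
    by (simp add: field_simps)
  then show ?thesis
    unfolding witness_point_def scaleR_Pair add_Pair single_midpoint
    by (simp only:) simp
qed

lemma witness_not_convex: "\<not> convex (nbp_feasible witness_params)"
proof
  assume "convex (nbp_feasible witness_params)"
  then have "(1/2) *\<^sub>R witness_point (1/10) (4/10) + (1/2) *\<^sub>R witness_point (4/10) (1/10)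
               \<in> nbp_feasible witness_params"
    by (intro convexD witness_feasible) auto
  \<comment> \<open>At the midpoint \<open>c\<close> = \<open>q\<close> = 1/4, so the relay utility
    is 1/20 - 1/16 = -1/80.\<close>
  from feasible_UR_pos[OF this] show False
    unfolding witness_midpoint witness_UR by simp
qed

theorem mainTheorem4:
  shows "\<exists>p :: nbp_params. nbp_params_valid p \<and>
           \<not> (convex (nbp_feasible p) \<and> concave_on (nbp_feasible p) (nbp_objective p))"
  using witness_params_valid witness_not_convex by blast

end
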